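(* Consider three-colored partitions whose parts are of the form $k_a$, $k_b$, $k_c$ with $k\ge1$ a positive integer and $a,b,c$ colors, ordered $1_a<1_b<1_c<2_a<2_b<2_c<3_a<\cdots$. Let $\Lambda^\star$ be the set of such partitions that contain no pair of parts of the form $j_a$ and $j_b$, no pair $j_b$ and $j_c$, and no pair $j_c$ and $(j+1)_a$ (for any $j\ge1$). For $\lambda\in\Lambda^\star$ let $|\lambda|$ be the sum of the parts ignoring color (a part $k_x$ contributes $k$), and let $\#_a(\lambda)$, $\#_c(\lambda)$ be the numbers of parts of color $a$, resp. $c$. Then $$\sum_{\lambda\in\Lambda^\star}A^{\#_a(\lambda)}C^{\#_c(\lambda)}q^{|\lambda|}=\frac{1}{(q;q)_\infty\,(Aq;q^2)_\infty\,(Cq;q^2)_\infty}.$$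
   Context: $(a;q)_\infty=\prod_{j\ge0}(1-aq^j)$. A colored partition is a finite multiset of colored parts; parts may repeat. *)

theory Defs
  imports "HOL-Library.Multiset" "HOL-Computational_Algebra.Formal_Power_Series"
begin

datatype color = Ca | Cb | Cc

type_synonym cpart = "(nat \<times> color) multiset"

definition Lambda_star :: "cpart set" where
  "Lambda_star = {P. (\<forall>p\<in>#P. fst p \<ge> 1) \<and>
     (\<forall>j\<ge>1. \<not> ((j, Ca) \<in># P \<and> (j, Cb) \<in># P)) \<and>
     (\<forall>j\<ge>1. \<not> ((j, Cb) \<in># P \<and> (j, Cc) \<in># P)) \<and>
     (\<forall>j\<ge>1. \<not> ((j, Cc) \<in># P \<and> (j + 1, Ca) \<in># P))}"

definition psize :: "cpart \<Rightarrow> nat" where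
  "psize P = sum_mset (image_mset fst P)"

definition ncol :: "color \<Rightarrow> cpart \<Rightarrow> nat" where
  "ncol x P = size (filter_mset (\<lambda>p. snd p = x) P)"

definition gen_series :: "'a::field \<Rightarrow> 'a \<Rightarrow> 'a fps" where
  "gen_series A C = Abs_fps (\<lambda>n. \<Sum>P\<in>{P\<in>Lambda_star. psize P = n}.
       A ^ ncol Ca P * C ^ ncol Cc P)"

text \<open>(a q^s; q^k)_\<infinity> as a formal power series in q (s, k \<ge> 1): the n-th coefficient
  is stable from the finite product over j \<le> n on.\<close>
definition qpoch_inf :: "'a::comm_ring_1 \<Rightarrow> nat \<Rightarrow> nat \<Rightarrow> 'a fps" where
  "qpoch_inf a s k = Abs_fps (\<lambda>n. fps_nth (\<Prod>j<n+1. 1 - fps_const a * fps_X ^ (s + k * j)) n)"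

end

theory Submission
  imports Defs
begin

text \<open>
  Arrange the colored parts on the path 1a, 1b, 1c, 2a, \<dots>: membership in Lambda_star says that no
  two neighbours on the path both occur. Hence the generating function G(n) of the
  partitions with parts up to n, and the generating function H(n) where (n+1)a is allowed as well,
  satisfy linear recurrences. Clearing the denominators (q)_n (Aq)_n (Cq)_n, and for H(n) also
  1 - Aq^(n+1), turns G(n) and H(n) into polynomials p(n) and e(n) in A, C, q, and these obey the functional equation
  e(n+1)(A, C) = (1 - Aq^2) (1 - Cq^2) p(n)(Aq^2, Cq^2). As p(n) and e(n) have the same limit, that
  limit is (Aq^2; q^2)_\<infinity> (Cq^2; q^2)_\<infinity>, which cancels the even factors of
  (Aq; q)_\<infinity> (Cq; q)_\<infinity>.
\<close>

section \<open>Partitions on a path\<close>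

fun next_part :: "nat \<times> color \<Rightarrow> nat \<times> color" where
  "next_part (k, Ca) = (k, Cb)"
| "next_part (k, Cb) = (k, Cc)"
| "next_part (k, Cc) = (Suc k, Ca)"

lemma next_part_neq: "next_part p \<noteq> p"
  by (cases p rule: next_part.cases) auto

text \<open>The three forbidden patterns are the three kinds of edges of the path, told apart by the
  color of the smaller endpoint. Merging them removes color case distinctions from the arguments on
  sets of allowed parts.\<close>

lemma Lambda_star_iff:
  "P \<in> Lambda_star \<longleftrightarrow> (\<forall>p\<in>#P. 1 \<le> fst p \<and> next_part p \<notin># P)" (is "?L \<longleftrightarrow> ?R")
proof
  assume L: ?L
  show ?R
  proof
    fix p assume "p \<in># P"
    with L show "1 \<le> fst p \<and> next_part p \<notin># P"
      by (cases p rule: next_part.cases) (force simp: Lambda_star_def)+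
  qed
next
  assume ?R
  then show ?L
    unfolding Lambda_star_def by fastforce
qed

definition Lambda_in :: "(nat \<times> color) set \<Rightarrow> cpart set" where
  "Lambda_in T = {P \<in> Lambda_star. set_mset P \<subseteq> T}"

lemma Lambda_in_subset: "Lambda_in T \<subseteq> Lambda_star"
  by (auto simp: Lambda_in_def)

lemma Lambda_in_empty: "Lambda_in {} = {{#}}"
  by (auto simp: Lambda_in_def Lambda_star_iff)

text \<open>If \<open>p\<close> occurs, strip one copy: the rest may still contain \<open>p\<close>
  but not its predecessor. As \<open>next_part p\<close> is not in \<open>T\<close>, the predecessor
  is the only neighbour of \<open>p\<close> to exclude.\<close>

lemma Lambda_in_insert:
  assumes "p \<notin> T" "next_part p \<notin> T" "1 \<le> fst p"
  shows "Lambda_in (insert p T) =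
    Lambda_in T \<union> add_mset p ` Lambda_in (insert p {r \<in> T. next_part r \<noteq> p})"
    (is "?L = ?R")
proof
  show "?L \<subseteq> ?R"
  proof
    fix P assume P: "P \<in> ?L"
    show "P \<in> ?R"
    proof (cases "p \<in># P")
      case True
      then obtain Q where Q: "P = add_mset p Q" by (metis insert_DiffM)
      have "Q \<in> Lambda_in (insert p {r \<in> T. next_part r \<noteq> p})"
        using P by (auto simp: Q Lambda_in_def Lambda_star_iff)
      then show ?thesis using Q by blast
    next
      case False
      then show ?thesis using P by (auto simp: Lambda_in_def)
    qed
  qed
  have "add_mset p Q \<in> ?L" if Q: "Q \<in> Lambda_in (insert p {r \<in> T. next_part r \<noteq> p})" for Q
  proof -
    have "next_part p \<notin># Q" "\<forall>r\<in>#Q. next_part r \<noteq> p"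
      using Q assms(2) next_part_neq[of p] by (auto simp: Lambda_in_def)
    then show ?thesis
      using Q assms(3) next_part_neq[of p] by (auto simp: Lambda_in_def Lambda_star_iff)
  qed
  then show "?R \<subseteq> ?L" by (auto simp: Lambda_in_def)
qed

lemma size_le_psize:
  assumes "\<forall>p\<in>#P. 1 \<le> fst p"
  shows "size P \<le> psize P"
  using assms by (induction P) (force simp: psize_def)+

lemma part_le_psize: "p \<in># P \<Longrightarrow> fst p \<le> psize P"
  by (induction P) (auto simp: psize_def)

text \<open>All parts are positive, so there are at most \<open>n\<close> of them and each is at
  most \<open>n\<close>; the partitions are images of short lists over a finite alphabet. Without
  finiteness the sums in \<open>gf\<close> would default to 0.\<close>

lemma finite_Lambda_star_psize:
  assumes "S \<subseteq> Lambda_star"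
  shows "finite {P \<in> S. psize P = n}"
proof (rule finite_subset)
  let ?T = "{1..n} \<times> {Ca, Cb, Cc}"
  show "finite (mset ` {xs. set xs \<subseteq> ?T \<and> length xs \<le> n})"
    by (intro finite_imageI finite_lists_length_le) auto
  show "{P \<in> S. psize P = n} \<subseteq> mset ` {xs. set xs \<subseteq> ?T \<and> length xs \<le> n}"
  proof
    fix P assume "P \<in> {P \<in> S. psize P = n}"
    then have "P \<in> Lambda_star" and n: "psize P = n"
      using assms by auto
    then have pos: "\<forall>p\<in>#P. 1 \<le> fst p"
      by (simp add: Lambda_star_iff)
    obtain xs where xs: "mset xs = P" using ex_mset by blast
    have "x \<in> ?T" if "x \<in># P" for x
      using pos that part_le_psize[OF that] n by (cases x; cases "snd x") auto
    moreover have "length xs \<le> n"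
      using size_le_psize[OF pos] n xs by auto
    ultimately show "P \<in> mset ` {xs. set xs \<subseteq> ?T \<and> length xs \<le> n}"
      using xs by fastforce
  qed
qed

section \<open>Generating functions weighted by color\<close>

definition gf :: "'a::field \<Rightarrow> 'a \<Rightarrow> cpart set \<Rightarrow> 'a fps" where
  "gf A C S = Abs_fps (\<lambda>n. \<Sum>P\<in>{P\<in>S. psize P = n}. A ^ ncol Ca P * C ^ ncol Cc P)"

lemma gf_Un:
  assumes "S \<subseteq> Lambda_star" "S' \<subseteq> Lambda_star" "S \<inter> S' = {}"
  shows "gf A C (S \<union> S') = gf A C S + gf A C S'"
proof (rule fps_ext)
  fix n
  have "{P \<in> S \<union> S'. psize P = n} = {P \<in> S. psize P = n} \<union> {P \<in> S'. psize P = n}" by auto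
  then show "fps_nth (gf A C (S \<union> S')) n = fps_nth (gf A C S + gf A C S') n"
    using assms finite_Lambda_star_psize
    by (auto simp: gf_def intro!: sum.union_disjoint)
qed

definition color_wt :: "'a::field \<Rightarrow> 'a \<Rightarrow> color \<Rightarrow> 'a" where
  "color_wt A C x = (case x of Ca \<Rightarrow> A | Cb \<Rightarrow> 1 | Cc \<Rightarrow> C)"

lemma gf_add_mset:
  "gf A C (add_mset p ` S) = fps_const (color_wt A C (snd p)) * fps_X ^ fst p * gf A C S"
proof (rule fps_ext)
  fix n
  have "fps_nth (gf A C (add_mset p ` S)) n =
      (\<Sum>P\<in>add_mset p ` {P \<in> S. psize P + fst p = n}. A ^ ncol Ca P * C ^ ncol Cc P)"
    by (auto simp: gf_def psize_def intro!: sum.cong)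
  also have "\<dots> = (\<Sum>P\<in>{P \<in> S. psize P + fst p = n}.
      color_wt A C (snd p) * (A ^ ncol Ca P * C ^ ncol Cc P))"
    by (subst sum.reindex)
      (auto simp: inj_on_def ncol_def color_wt_def mult_ac split: color.split intro!: sum.cong)
  also have "\<dots> = fps_nth (fps_const (color_wt A C (snd p)) * fps_X ^ fst p * gf A C S) n"
  proof (cases "n < fst p")
    case True
    then have "{P \<in> S. psize P + fst p = n} = {}" by auto
    then show ?thesis using True by (simp add: mult.assoc fps_X_power_mult_nth)
  next
    case False
    then have "{P \<in> S. psize P + fst p = n} = {P \<in> S. psize P = n - fst p}" by auto
    then show ?thesis using False
      by (simp add: mult.assoc fps_X_power_mult_nth gf_def sum_distrib_left)
  qed
  finally show "fps_nth (gf A C (add_mset p ` S)) n =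
    fps_nth (fps_const (color_wt A C (snd p)) * fps_X ^ fst p * gf A C S) n" .
qed

text \<open>The partitions that contain \<open>p\<close> contribute a geometric series in
  \<open>w\<close> times those that avoid both \<open>p\<close> and its predecessor. Multiplying by
  \<open>1 - w\<close> avoids the division.\<close>

lemma gf_Lambda_in_insert:
  fixes A C :: "'a::field"
  assumes "p \<notin> T" "next_part p \<notin> T" "1 \<le> fst p"
  defines "w \<equiv> fps_const (color_wt A C (snd p)) * fps_X ^ fst p"
  shows "(1 - w) * (gf A C (Lambda_in (insert p T)) - gf A C (Lambda_in T)) =
    w * gf A C (Lambda_in {r \<in> T. next_part r \<noteq> p})"
proof -
  let ?T' = "{r \<in> T. next_part r \<noteq> p}"
  have gf_insert: "gf A C (Lambda_in (insert p U)) =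
      gf A C (Lambda_in U) + w * gf A C (Lambda_in (insert p {r \<in> U. next_part r \<noteq> p}))"
    if U: "p \<notin> U" "next_part p \<notin> U" for U
  proof -
    let ?V = "Lambda_in (insert p {r \<in> U. next_part r \<noteq> p})"
    note eq = Lambda_in_insert[OF U assms(3)]
    have "gf A C (Lambda_in U \<union> add_mset p ` ?V) =
        gf A C (Lambda_in U) + gf A C (add_mset p ` ?V)"
    proof (rule gf_Un)
      show "add_mset p ` ?V \<subseteq> Lambda_star"
        using eq Lambda_in_subset[of "insert p U"] by blast
      show "Lambda_in U \<inter> add_mset p ` ?V = {}"
        using U by (auto simp: Lambda_in_def)
    qed (rule Lambda_in_subset)
    then show ?thesis unfolding eq gf_add_mset w_def .
  qed
  define V where "V = gf A C (Lambda_in (insert p ?T'))"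
  have T: "gf A C (Lambda_in (insert p T)) = gf A C (Lambda_in T) + w * V"
    using gf_insert[of T] assms(1,2) unfolding V_def by blast
  \<comment> \<open>Removing the predecessor of \<open>p\<close> a second time changes nothing, so
    the recursion for \<open>?T'\<close> refers to \<open>V\<close> itself and can be
    solved.\<close>
  have "{r \<in> ?T'. next_part r \<noteq> p} = ?T'" by auto
  then have "V = gf A C (Lambda_in ?T') + w * V"
    using gf_insert[of ?T'] assms(1,2) unfolding V_def by simp
  then have T': "gf A C (Lambda_in ?T') = V - w * V" by (simp add: eq_diff_eq)
  show ?thesis unfolding T T' by (simp add: algebra_simps)
qed


section \<open>The polynomial recurrence\<close>

text \<open>These are p(n) and e(n) of the overview, over an arbitrary ring so that \<open>a\<close>
  and \<open>c\<close> can be rescaled by powers of \<open>q\<close>. The exponent 2n+3 is the joint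
  size of the neighbours (n+1)c and (n+2)a.\<close>

fun ppoly epoly :: "'b::comm_ring_1 \<Rightarrow> 'b \<Rightarrow> 'b \<Rightarrow> nat \<Rightarrow> 'b" where
  "ppoly q a c 0 = 1"
| "ppoly q a c (Suc n) =
    q ^ Suc n * (1 - a * q ^ Suc n) * (1 - c * q ^ Suc n) * ppoly q a c n
      + (1 - q ^ Suc n) * epoly q a c n"
| "epoly q a c 0 = 1"
| "epoly q a c (Suc n) =
    ppoly q a c (Suc n) - a * c * q ^ (2 * n + 3) * (1 - q ^ Suc n) * epoly q a c n"

text \<open>The first identity only goes through by induction together with the second one, which
  expresses the shifted e(n) by unshifted terms.\<close>
lemma epoly_Suc_shift_aux:
  fixes q a c :: "'b::idom"
  defines "k \<equiv> (1 - a * q\<^sup>2) * (1 - c * q\<^sup>2)"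
  shows "epoly q a c (Suc n) = k * ppoly q (a * q\<^sup>2) (c * q\<^sup>2) n \<and>
    k * epoly q (a * q\<^sup>2) (c * q\<^sup>2) n =
      (1 - a * c * q ^ (2 * n + 5)) * epoly q a c (Suc n)
      + a * c * q ^ (3 * n + 5) * (1 - a * q ^ (n + 2)) * (1 - c * q ^ (n + 2)) * epoly q a c n"
    (is "?I n \<and> ?J n")
proof (induction n)
  case 0
  have e1: "epoly q a c (Suc 0) = k" unfolding k_def by (simp add: algebra_simps eval_nat_numeral)
  have "k = (1 - a * c * q ^ 5) * k + a * c * q ^ 5 * (1 - a * q\<^sup>2) * (1 - c * q\<^sup>2)"
    unfolding k_def by algebra
  then show ?case
    unfolding e1 by (simp del: epoly.simps(2) add: epoly.simps(1) numeral_2_eq_2)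
next
  case (Suc n)
  \<comment> \<open>With \<open>Q\<close> as an independent variable, every claim for general
    \<open>n\<close> becomes a polynomial identity.\<close>
  define Q where "Q = q ^ n"
  define e0 where "e0 = epoly q a c n"
  define e1 where "e1 = epoly q a c (Suc n)"
  define e2 where "e2 = epoly q a c (Suc (Suc n))"
  define p1 where "p1 = ppoly q a c (Suc n)"
  define P where "P = k * ppoly q (a * q\<^sup>2) (c * q\<^sup>2) n"
  define P' where "P' = k * ppoly q (a * q\<^sup>2) (c * q\<^sup>2) (Suc n)"
  define E where "E = k * epoly q (a * q\<^sup>2) (c * q\<^sup>2) n"
  define E' where "E' = k * epoly q (a * q\<^sup>2) (c * q\<^sup>2) (Suc n)"
  have pw: "q ^ (2 * m) = q ^ m * q ^ m" "q ^ (3 * m) = q ^ m * q ^ m * q ^ m" for m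
    by (simp_all add: mult_2 power_add eval_nat_numeral)
  note pws = power_add power_Suc pw Q_def [symmetric]
  have I: "P = e1" and J: "E = (1 - a * c * (Q * Q * q ^ 5)) * e1
      + a * c * (Q * Q * Q * q ^ 5) * (1 - a * (Q * q\<^sup>2)) * (1 - c * (Q * q\<^sup>2)) * e0"
    using Suc.IH unfolding P_def E_def e1_def e0_def by (simp_all only: pws)
  have p1: "p1 = e1 + a * c * (Q * Q * q ^ 3) * (1 - q * Q) * e0"
    unfolding e1_def p1_def e0_def epoly.simps(2)[of q a c n] pws by simp
  have e2: "e2 = (q * (q * Q)) * (1 - a * (q * (q * Q))) *
      (1 - c * (q * (q * Q))) * p1 + (1 - q * (q * Q)) * e1
      - a * c * (q * Q * (q * Q) * q ^ 3) * (1 - q * (q * Q)) * e1"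
    unfolding e2_def epoly.simps(2)[of q a c "Suc n"] ppoly.simps(2)[of q a c "Suc n"]
      p1_def[symmetric] e1_def[symmetric] pws ..
  have P': "P' = q * Q * (1 - a * q\<^sup>2 * (q * Q)) * (1 - c * q\<^sup>2 * (q * Q)) * P + (1 - q * Q) * E"
    unfolding P'_def ppoly.simps(2) P_def E_def pws by algebra
  have E': "E' = P' - a * q\<^sup>2 * (c * q\<^sup>2) * (Q * Q * q ^ 3) * (1 - q * Q) * E"
    unfolding P'_def E'_def epoly.simps(2)[of q "a * q\<^sup>2" "c * q\<^sup>2" n] E_def pws by algebra
  \<comment> \<open>\<open>P'\<close> involves the shifted \<open>E\<close>; the second induction
    hypothesis \<open>J\<close> rewrites it by unshifted terms.\<close>
  have I': "e2 = P'"
    unfolding e2 P' p1 I J by algebra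
  have "(1 - q * Q) * E = e2 - q * Q * (1 - a * q\<^sup>2 * (q * Q)) * (1 - c * q\<^sup>2 * (q * Q)) * e1"
    using P' I I' by simp
  then have "E' = e2 - a * q\<^sup>2 * (c * q\<^sup>2) * (Q * Q * q ^ 3) *
      (e2 - q * Q * (1 - a * q\<^sup>2 * (q * Q)) * (1 - c * q\<^sup>2 * (q * Q)) * e1)"
    unfolding E' I'[symmetric] mult.assoc by simp
  also have "\<dots> = (1 - a * c * (Q * Q * q ^ 7)) * e2
      + a * c * (Q * Q * Q * q ^ 8) * (1 - a * (Q * q ^ 3)) * (1 - c * (Q * q ^ 3)) * e1"
    by algebra
  finally have "E' = (1 - a * c * (Q * Q * q ^ 7)) * e2
      + a * c * (Q * Q * Q * q ^ 8) * (1 - a * (Q * q ^ 3)) * (1 - c * (Q * q ^ 3)) * e1" .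
  moreover have "q ^ (2 * Suc n + 5) = Q * Q * q ^ 7" "q ^ (3 * Suc n + 5) = Q * Q * Q * q ^ 8"
    "q ^ (Suc n + 2) = Q * q ^ 3"
    unfolding pws by algebra+
  ultimately show ?case
    using I' unfolding e2_def P'_def E'_def e1_def by metis
qed

lemmas epoly_Suc_shift = epoly_Suc_shift_aux [THEN conjunct1]

text \<open>Modulo \<open>d\<close>, where \<open>a\<close> and \<open>c\<close> vanish, the new p
  is a combination of the old p and e with coefficients summing to 1, and the new e equals the new
  p. So the initial value 1 persists.\<close>

lemma ppoly_epoly_cong_1:
  fixes q a c :: "'b::comm_ring_1"
  assumes "d dvd a" "d dvd c"
  shows "d dvd ppoly q a c n - 1 \<and> d dvd epoly q a c n - 1"
proof (induction n)
  case (Suc n)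
  define u x y where "u = q ^ Suc n" and "x = a * u" and "y = c * u"
  have eq: "ppoly q a c (Suc n) - 1 = u * (ppoly q a c n - 1)
      - x * (u * ppoly q a c n) - y * (u * (1 - x) * ppoly q a c n) + (1 - u) * (epoly q a c n - 1)"
    unfolding ppoly.simps u_def[symmetric] x_def[symmetric] y_def[symmetric]
    by (simp add: algebra_simps)
  have xy: "d dvd x" "d dvd y" using assms by (simp_all add: x_def y_def)
  have p: "d dvd ppoly q a c (Suc n) - 1"
    unfolding eq using Suc xy by (intro dvd_add dvd_diff) (auto intro: dvd_mult dvd_mult2)
  have "epoly q a c (Suc n) - 1 = (ppoly q a c (Suc n) - 1)
      - a * (c * q ^ (2 * n + 3) * (1 - q ^ Suc n) * epoly q a c n)"
    unfolding epoly.simps by (simp add: algebra_simps)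
  with p assms show ?case by (metis dvd_diff dvd_mult2)
qed auto

text \<open>This iterates the functional equation \<open>m\<close> times. Each round trades p for e,
  at the cost of a multiple of \<open>q ^ n\<close>, then lowers the index by one and rescales
  \<open>a\<close> and \<open>c\<close> by \<open>q\<^sup>2\<close>.\<close>

lemma ppoly_cong_prod:
  fixes q a c :: "'b::idom"
  shows "q ^ n dvd ppoly q a c (n + m)
    - (\<Prod>j<m. (1 - a * q ^ (2 * j + 2)) * (1 - c * q ^ (2 * j + 2)))
        * ppoly q (a * q ^ (2 * m)) (c * q ^ (2 * m)) n"
proof (induction m arbitrary: a c)
  case (Suc m)
  define k where "k = (1 - a * q\<^sup>2) * (1 - c * q\<^sup>2)"
  define R where "R = (\<Prod>j<m. (1 - a * q\<^sup>2 * q ^ (2 * j + 2)) * (1 - c * q\<^sup>2 * q ^ (2 * j + 2)))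
        * ppoly q (a * q\<^sup>2 * q ^ (2 * m)) (c * q\<^sup>2 * q ^ (2 * m)) n"
  define N where "N = n + m"
  have "(\<Prod>j<Suc m. (1 - a * q ^ (2 * j + 2)) * (1 - c * q ^ (2 * j + 2)))
        * ppoly q (a * q ^ (2 * Suc m)) (c * q ^ (2 * Suc m)) n = k * R"
    unfolding prod.lessThan_Suc_shift k_def R_def
    by (simp add: mult.assoc power_add power2_eq_square)
  moreover have "ppoly q a c (n + Suc m) = k * ppoly q (a * q\<^sup>2) (c * q\<^sup>2) N
      + q ^ n * (a * c * q ^ (n + 2 * m + 3) * (1 - q ^ Suc N) * epoly q a c N)"
  proof -
    have "2 * N + 3 = n + (n + 2 * m + 3)" by (simp add: N_def)
    then have "q ^ (2 * N + 3) = q ^ n * q ^ (n + 2 * m + 3)" by (simp only: power_add)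
    then have "ppoly q a c (Suc N) = epoly q a c (Suc N)
        + q ^ n * (a * c * q ^ (n + 2 * m + 3) * (1 - q ^ Suc N) * epoly q a c N)"
      unfolding epoly.simps by (simp del: ppoly.simps)
    then show ?thesis
      unfolding epoly_Suc_shift k_def[symmetric] by (simp only: N_def add_Suc_right)
  qed
  ultimately have eq: "ppoly q a c (n + Suc m) -
      (\<Prod>j<Suc m. (1 - a * q ^ (2 * j + 2)) * (1 - c * q ^ (2 * j + 2)))
        * ppoly q (a * q ^ (2 * Suc m)) (c * q ^ (2 * Suc m)) n =
      k * (ppoly q (a * q\<^sup>2) (c * q\<^sup>2) N - R)
      + q ^ n * (a * c * q ^ (n + 2 * m + 3) * (1 - q ^ Suc N) * epoly q a c N)"
    by (simp add: algebra_simps)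
  have "q ^ n dvd ppoly q (a * q\<^sup>2) (c * q\<^sup>2) N - R"
    using Suc.IH[of "a * q\<^sup>2" "c * q\<^sup>2"] unfolding R_def N_def .
  then show ?case unfolding eq by (rule dvd_add[OF dvd_mult dvd_triv_left])
qed simp


section \<open>Partitions with bounded parts\<close>

definition parts_upto :: "nat \<Rightarrow> (nat \<times> color) set" where
  "parts_upto n = {1..n} \<times> UNIV"

lemma parts_upto_0: "parts_upto 0 = {}"
  by (simp add: parts_upto_def)

lemma parts_upto_Suc:
  "parts_upto (Suc n) =
    insert (Suc n, Cc) (insert (Suc n, Cb) (insert (Suc n, Ca) (parts_upto n)))"
proof -
  have "UNIV = {Ca, Cb, Cc}" using color.exhaust by blast
  then show ?thesis by (auto simp: parts_upto_def)
qed

lemma gf_times_prod_eq_poly: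
  fixes A C :: "'a::field"
  defines "a \<equiv> fps_const A" and "c \<equiv> fps_const C"
  defines "W \<equiv> \<lambda>n. \<Prod>j<n. (1 - fps_X ^ Suc j) * (1 - a * fps_X ^ Suc j) * (1 - c * fps_X ^ Suc j)"
  shows "gf A C (Lambda_in (parts_upto n)) * W n = ppoly fps_X a c n \<and>
    (1 - a * fps_X ^ Suc n) * gf A C (Lambda_in (insert (Suc n, Ca) (parts_upto n))) * W n
      = epoly fps_X a c n"
proof -
  define G where "G n = gf A C (Lambda_in (parts_upto n))" for n
  define Ga where "Ga n = gf A C (Lambda_in (insert (Suc n, Ca) (parts_upto n)))" for n
  define Gb where "Gb n =
    gf A C (Lambda_in (insert (Suc n, Cb) (insert (Suc n, Ca) (parts_upto n))))" for n
  have mem: "(k, x) \<in> parts_upto n \<longleftrightarrow> 1 \<le> k \<and> k \<le> n" for k x n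
    by (auto simp: parts_upto_def)
  have nxt: "next_part r = (k, Cb) \<longleftrightarrow> r = (k, Ca)" "next_part r = (k, Cc) \<longleftrightarrow> r = (k, Cb)"
    "next_part r = (Suc k, Ca) \<longleftrightarrow> r = (k, Cc)" for r k
    by (cases r rule: next_part.cases; auto)+
  \<comment> \<open>Each of the three steps appends the next vertex of the path. The term on the
    right comes from the old set without its last vertex, the predecessor of the new part.\<close>
  have stepb: "(1 - fps_X ^ Suc n) * (Gb n - Ga n) = fps_X ^ Suc n * G n" for n
  proof -
    have "{r \<in> insert (Suc n, Ca) (parts_upto n). next_part r \<noteq> (Suc n, Cb)} = parts_upto n"
      by (auto simp: mem nxt)
    then show ?thesis
      using gf_Lambda_in_insert[of "(Suc n, Cb)" "insert (Suc n, Ca) (parts_upto n)" A C]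
      by (simp add: mem color_wt_def G_def Ga_def Gb_def)
  qed
  have stepc: "(1 - c * fps_X ^ Suc n) * (G (Suc n) - Gb n) = c * fps_X ^ Suc n * Ga n" for n
  proof -
    let ?T = "insert (Suc n, Cb) (insert (Suc n, Ca) (parts_upto n))"
    have "{r \<in> ?T. next_part r \<noteq> (Suc n, Cc)} = insert (Suc n, Ca) (parts_upto n)"
      by (auto simp: mem nxt)
    then show ?thesis
      using gf_Lambda_in_insert[of "(Suc n, Cc)" ?T A C]
      by (simp add: mem color_wt_def G_def Ga_def Gb_def c_def parts_upto_Suc)
  qed
  have stepa: "(1 - a * fps_X ^ Suc (Suc n)) * (Ga (Suc n) - G (Suc n)) =
      a * fps_X ^ Suc (Suc n) * Gb n" for n
  proof -
    have "{r \<in> parts_upto (Suc n). next_part r \<noteq> (Suc (Suc n), Ca)} =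
        insert (Suc n, Cb) (insert (Suc n, Ca) (parts_upto n))"
      unfolding parts_upto_Suc by (auto simp: mem nxt)
    then show ?thesis
      using gf_Lambda_in_insert[of "(Suc (Suc n), Ca)" "parts_upto (Suc n)" A C]
      by (simp add: mem color_wt_def G_def Ga_def Gb_def a_def)
  qed
  have "{P. P = {#} \<and> psize P = n} = (if n = 0 then {{#}} else {})" for n
    by (auto simp: psize_def)
  then have G0: "G 0 = 1"
    by (auto simp: G_def parts_upto_0 Lambda_in_empty gf_def ncol_def intro!: fps_ext)
  have "(1 - a * fps_X) * (Ga 0 - G 0) = a * fps_X * G 0"
    using gf_Lambda_in_insert[of "(Suc 0, Ca)" "{}" A C]
    by (simp add: parts_upto_0 color_wt_def G_def Ga_def a_def)
  then have Ga0: "(1 - a * fps_X) * Ga 0 = 1"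
    unfolding G0 by (simp add: algebra_simps)
  have "G n * W n = ppoly fps_X a c n \<and>
    (1 - a * fps_X ^ Suc n) * Ga n * W n = epoly fps_X a c n"
  proof (induction n)
    case 0
    then show ?case by (simp add: G0 Ga0 W_def)
  next
    case (Suc n)
    define u where "u = (fps_X ^ Suc n :: 'a fps)"
    have u': "fps_X ^ Suc (Suc n) = u * fps_X" "fps_X ^ (2 * n + 3) = u * u * fps_X"
      by (simp_all add: u_def eval_nat_numeral mult_ac power_add mult_2)
    have W: "W (Suc n) = W n * ((1 - u) * (1 - a * u) * (1 - c * u))"
      by (simp add: W_def u_def)
    note IH = Suc.IH[THEN conjunct1] Suc.IH[THEN conjunct2, folded u_def]
    note steps = stepa[of n, unfolded u'] stepb[of n, folded u_def] stepc[of n, folded u_def]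
    have p: "G (Suc n) * W (Suc n) = ppoly fps_X a c (Suc n)"
      unfolding ppoly.simps u_def[symmetric] W IH[symmetric] 
    proof -
      \<comment> \<open>The two sides differ by a combination of \<open>stepc\<close> and
        \<open>stepb\<close> in which \<open>Gb n\<close> cancels. The claim for e below eliminates
        \<open>Gb n\<close> likewise from \<open>stepa\<close> and \<open>stepc\<close>.\<close>
      have "G (Suc n) * (W n * ((1 - u) * (1 - a * u) * (1 - c * u)))
          - (u * (1 - a * u) * (1 - c * u) * (G n * W n) + (1 - u) * ((1 - a * u) * Ga n * W n)) =
          W n * (1 - a * u) * (1 - u) * ((1 - c * u) * (G (Suc n) - Gb n) - c * u * Ga n)
          + W n * (1 - a * u) * (1 - c * u) * ((1 - u) * (Gb n - Ga n) - u * G n)"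
        by algebra
      also have "\<dots> = 0" using steps(2,3) by simp
      finally show "G (Suc n) * (W n * ((1 - u) * (1 - a * u) * (1 - c * u))) =
          u * (1 - a * u) * (1 - c * u) * (G n * W n) + (1 - u) * ((1 - a * u) * Ga n * W n)"
        by simp
    qed
    have "(1 - a * (u * fps_X)) * Ga (Suc n) * W (Suc n) -
        (G (Suc n) * W (Suc n) - a * c * (u * u * fps_X) * (1 - u) * ((1 - a * u) * Ga n * W n)) =
        W n * ((1 - u) * (1 - a * u) * (1 - c * u)) *
          ((1 - a * (u * fps_X)) * (Ga (Suc n) - G (Suc n)) - a * (u * fps_X) * Gb n)
        - a * (u * fps_X) * (W n * (1 - u) * (1 - a * u)) *
          ((1 - c * u) * (G (Suc n) - Gb n) - c * u * Ga n)"
      unfolding W by algebra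
    also have "\<dots> = 0" using steps(1,3) by simp
    finally show ?case
      using p unfolding epoly.simps u' u_def[symmetric] IH by simp
  qed
  then show ?thesis unfolding G_def Ga_def .
qed


section \<open>Passage to the limit\<close>

text \<open>Agreement of coefficients up to some order becomes a congruence, so limits can be
  handled by divisibility in the ring.\<close>

lemma fps_X_power_dvd_iff_nth:
  fixes f :: "'a::comm_ring_1 fps"
  shows "fps_X ^ n dvd f \<longleftrightarrow> (\<forall>i<n. fps_nth f i = 0)"
proof
  assume "\<forall>i<n. fps_nth f i = 0"
  then have "f = fps_X ^ n * fps_shift n f"
    by (intro fps_ext) (auto simp: fps_X_power_mult_nth)
  then show "fps_X ^ n dvd f" by (metis dvd_triv_left)
qed (auto simp: fps_X_power_mult_nth elim!: dvdE)

lemma dvd_diff_mult_cong: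
  fixes f g :: "'b::comm_ring_1"
  assumes "d dvd f - g" "d dvd f' - g'"
  shows "d dvd f * f' - g * g'"
proof -
  have "f * f' - g * g' = f * (f' - g') + g' * (f - g)" by (simp add: algebra_simps)
  then show ?thesis using assms by simp
qed

text \<open>The factor with index \<open>j\<close> affects only coefficients from
  \<open>s + k * j\<close> on, which is at least \<open>j\<close>; hence coefficient
  \<open>i\<close> is settled after \<open>Suc i\<close> factors.\<close>

lemma qpoch_inf_cong:
  fixes a :: "'a::comm_ring_1"
  assumes "1 \<le> k" "N \<le> n"
  shows "fps_X ^ N dvd qpoch_inf a s k - (\<Prod>j<n. 1 - fps_const a * fps_X ^ (s + k * j))"
  unfolding fps_X_power_dvd_iff_nth
proof (intro allI impI)
  fix i assume "i < N"
  with assms(2) have "Suc i \<le> n" by simp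
  then have "fps_nth (\<Prod>j<n. 1 - fps_const a * fps_X ^ (s + k * j)) i =
      fps_nth (\<Prod>j<Suc i. 1 - fps_const a * fps_X ^ (s + k * j)) i"
  proof (induction n rule: dec_induct)
    case (step n)
    have "n \<le> k * n" using assms(1) by simp
    with step have "i < s + k * n" by linarith
    then have "fps_nth (fps_X ^ (s + k * n) *
        (fps_const a * (\<Prod>j<n. 1 - fps_const a * fps_X ^ (s + k * j)))) i = 0"
      by (simp only: fps_X_power_mult_nth if_True)
    with step show ?case by (simp add: algebra_simps del: fps_mult_left_const_nth)
  qed simp
  then show "fps_nth (qpoch_inf a s k - (\<Prod>j<n. 1 - fps_const a * fps_X ^ (s + k * j))) i = 0"
    by (simp add: qpoch_inf_def del: prod.lessThan_Suc)
qed

text \<open>No part exceeds the total size, so the bound on the parts is invisible below degree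
  \<open>n\<close>.\<close>

lemma gen_series_cong:
  "fps_X ^ n dvd gen_series A C - gf A C (Lambda_in (parts_upto n))"
  unfolding fps_X_power_dvd_iff_nth
proof (intro allI impI)
  fix i assume i: "i < n"
  have "P \<in> Lambda_in (parts_upto n)" if "P \<in> Lambda_star" "psize P = i" for P
  proof -
    have "p \<in> parts_upto n" if "p \<in># P" for p
      using \<open>P \<in> Lambda_star\<close> \<open>psize P = i\<close> i part_le_psize[OF that] that
      by (cases p) (force simp: Lambda_star_iff parts_upto_def)
    with that(1) show ?thesis by (auto simp: Lambda_in_def)
  qed
  then have "{P \<in> Lambda_star. psize P = i} = {P \<in> Lambda_in (parts_upto n). psize P = i}"
    using Lambda_in_subset by blast
  then show "fps_nth (gen_series A C - gf A C (Lambda_in (parts_upto n))) i = 0"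
    by (simp add: gen_series_def gf_def)
qed

lemma prod_lessThan_double:
  fixes f :: "nat \<Rightarrow> 'b::comm_monoid_mult"
  shows "prod f {..<2 * m} = (\<Prod>j<m. f (2 * j)) * (\<Prod>j<m. f (2 * j + 1))"
  by (induction m) (simp_all add: mult_ac)

theorem theorem3p2:
  fixes A C :: "'a::field"
  shows "gen_series A C =
    inverse (qpoch_inf 1 1 1 * qpoch_inf A 1 2 * qpoch_inf C 1 2)"
proof -
  let ?X = "fps_X :: 'a fps"
  define B where "B = qpoch_inf (1::'a) 1 1 * qpoch_inf A 1 2 * qpoch_inf C 1 2"
  have cong: "?X ^ m dvd gen_series A C * B - 1" for m
  proof -
    define a c where "a = fps_const A" and "c = fps_const C"
    \<comment> \<open>Parts go up to \<open>2 * m\<close> so that the full denominator splits as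
      \<open>F * V\<close>: \<open>F\<close> truncates \<open>B\<close>, and \<open>V\<close>
      collects the even exponents of the \<open>a\<close> and \<open>c\<close> factors.\<close>
    define F where "F = (\<Prod>j<2 * m. 1 - fps_const 1 * ?X ^ (1 + 1 * j))
      * (\<Prod>j<m. 1 - a * ?X ^ (1 + 2 * j)) * (\<Prod>j<m. 1 - c * ?X ^ (1 + 2 * j))"
    define V where "V = (\<Prod>j<m. (1 - a * ?X ^ (2 * j + 2)) * (1 - c * ?X ^ (2 * j + 2)))"
    define G where "G = gf A C (Lambda_in (parts_upto (2 * m)))"
    have "?X ^ m dvd ?X ^ (2 * m)" by (simp add: le_imp_power_dvd)
    \<comment> \<open>Write the index \<open>2 * m\<close> as m + m: after \<open>m\<close> shifts
      both arguments carry \<open>?X ^ (2 * m)\<close>, so the remaining polynomial is 1 modulo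
      \<open>?X ^ m\<close>.\<close>
    then have "?X ^ m dvd ppoly ?X (a * ?X ^ (2 * m)) (c * ?X ^ (2 * m)) m - 1"
      by (intro ppoly_epoly_cong_1[THEN conjunct1] dvd_mult)
    from dvd_mult[OF this, of V]
    have "?X ^ m dvd V * ppoly ?X (a * ?X ^ (2 * m)) (c * ?X ^ (2 * m)) m - V"
      by (simp add: algebra_simps)
    from dvd_add[OF ppoly_cong_prod[of ?X m a c m, folded V_def] this]
    have "?X ^ m dvd ppoly ?X a c (2 * m) - V" by (simp add: mult_2)
    moreover have "ppoly ?X a c (2 * m) = G * F * V"
    proof -
      have double: "(\<Prod>j<2 * m. 1 - b * ?X ^ Suc j) =
          (\<Prod>j<m. 1 - b * ?X ^ (1 + 2 * j)) * (\<Prod>j<m. 1 - b * ?X ^ (2 * j + 2))" for b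
        by (simp add: prod_lessThan_double)
      have "(\<Prod>j<2 * m. (1 - ?X ^ Suc j) * (1 - a * ?X ^ Suc j) * (1 - c * ?X ^ Suc j)) = F * V"
        unfolding F_def V_def prod.distrib double by (simp add: mult_ac)
      then show ?thesis
        using gf_times_prod_eq_poly[of A C "2 * m"] by (simp add: G_def a_def c_def mult.assoc)
    qed
    ultimately have "?X ^ m dvd (G * F - 1) * V" by (simp add: algebra_simps)
    \<comment> \<open>\<open>V\<close> has constant term 1, so it is a unit and can be cancelled
      from the congruence.\<close>
    then have "?X ^ m dvd (G * F - 1) * V * inverse V" by (rule dvd_mult2)
    moreover have "fps_nth V 0 = 1"
      unfolding V_def by (induction m) simp_all
    then have "V * inverse V = 1" by (simp add: inverse_mult_eq_1')
    ultimately have GF: "?X ^ m dvd G * F - 1" by (simp add: mult.assoc)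
    have "?X ^ m dvd B - F"
      unfolding B_def F_def a_def c_def by (intro dvd_diff_mult_cong qpoch_inf_cong) auto
    moreover have "?X ^ m dvd gen_series A C - G"
      unfolding G_def using dvd_trans[OF \<open>?X ^ m dvd ?X ^ (2 * m)\<close> gen_series_cong] .
    ultimately have "?X ^ m dvd gen_series A C * B - G * F"
      by (intro dvd_diff_mult_cong)
    from dvd_add[OF this GF] show ?thesis by simp
  qed
  have "gen_series A C * B - 1 = 0"
  proof (rule fps_ext)
    fix i
    show "fps_nth (gen_series A C * B - 1) i = fps_nth 0 i"
      using cong[of "Suc i"] unfolding fps_X_power_dvd_iff_nth by simp
  qed
  then have "B * gen_series A C = 1" by (simp add: mult.commute)
  then show ?thesis
    unfolding B_def[symmetric] by (metis fps_inverse_unique)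
qed

end
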